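(* For any $1<p<q<\infty$, there exists a nontrivial $(p,q)$-critical extremizer for $\mathbb{Z}_3$.
   Context: Let $\mathbb{Z}_3=\mathbb{Z}/3\mathbb{Z}$ be equipped with the uniform probability measure, and let $L^p(\mathbb{Z}_3)$ be the space of complex-valued functions on $\mathbb{Z}_3$ with $\|f\|_p=\big(\frac13\sum_{k\in\mathbb{Z}_3}|f(k)|^p\big)^{1/p}$. Let $\chi$ be the character of $\mathbb{Z}_3$ with $\chi(1)=e^{2\pi i/3}$, so that every function is uniquely $f=a_0+a_1\chi+a_2\overline{\chi}$ with $a_0,a_1,a_2\in\mathbb{C}$. For $r\in[0,1]$ define $T_r(a_0+a_1\chi+a_2\overline{\chi})=a_0+ra_1\chi+ra_2\overline{\chi}$. For $1<p<q<\infty$, $r_{p,q}(\mathbb{Z}_3)\in[0,1]$ is the largest constant such that $\|T_rf\|_q\le\|f\|_p$ for all $0\le r\le r_{p,q}(\mathbb{Z}_3)$ and all $f\in L^p(\mathbb{Z}_3)$. A nontrivial $(p,q)$-critical extremizer for $\mathbb{Z}_3$ is a non-constant function $f$ on $\mathbb{Z}_3$ such that $\|T_rf\|_q=\|f\|_p$ for $r=r_{p,q}(\mathbb{Z}_3)$. *)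

theory Defs
  imports "HOL-Analysis.Analysis"
begin

text \<open>
  The group \<open>\<int>/3\<int>\<close> is the numeral type \<^typ>\<open>3\<close>, whose ring operations are
  arithmetic modulo 3; \<^term>\<open>Rep_bit1\<close> sends an element to its representative in \<open>{0, 1, 2}\<close>.
\<close>

definition character :: "3 \<Rightarrow> complex" where
  "character k = exp (2 * of_real pi * \<i> / 3) ^ nat (Rep_bit1 k)"

definition Lp_norm :: "real \<Rightarrow> (3 \<Rightarrow> complex) \<Rightarrow> real" where
  "Lp_norm p f = (1 / 3 * (\<Sum>k\<in>UNIV. norm (f k) powr p)) powr (1 / p)"

definition char_comb :: "complex \<Rightarrow> complex \<Rightarrow> complex \<Rightarrow> 3 \<Rightarrow> complex" where
  "char_comb a0 a1 a2 = (\<lambda>k. a0 + a1 * character k + a2 * cnj (character k))"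

text \<open>
  The description below is justified by \<open>char_comb_exists\<close> and \<open>char_comb_inject\<close>;
  \<open>T_char_comb\<close> is the resulting equation.
\<close>

definition T :: "real \<Rightarrow> (3 \<Rightarrow> complex) \<Rightarrow> 3 \<Rightarrow> complex" where
  "T r f = (THE g. \<exists>a0 a1 a2. f = char_comb a0 a1 a2 \<and>
     g = char_comb a0 (of_real r * a1) (of_real r * a2))"

text \<open>The greatest element exists for \<open>1 \<le> p\<close> and \<open>0 < q\<close>; see \<open>r_crit_greatest\<close>.\<close>

definition r_crit :: "real \<Rightarrow> real \<Rightarrow> real" where
  "r_crit p q = (GREATEST s. 0 \<le> s \<and> s \<le> 1 \<and>
     (\<forall>r. 0 \<le> r \<and> r \<le> s \<longrightarrow> (\<forall>f. Lp_norm q (T r f) \<le> Lp_norm p f)))"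

definition nontrivial_critical_extremizer :: "real \<Rightarrow> real \<Rightarrow> (3 \<Rightarrow> complex) \<Rightarrow> bool" where
  "nontrivial_critical_extremizer p q f \<longleftrightarrow>
     \<not> f constant_on UNIV \<and> Lp_norm q (T (r_crit p q) f) = Lp_norm p f"


subsection \<open>The definitions are meaningful\<close>

lemma Z3_exhaust: "k = 0 \<or> k = 1 \<or> k = 2" for k :: 3
  using exhaust_3[of k] by auto

lemma sum_Z3: "(\<Sum>k\<in>UNIV. f k) = f 0 + f 1 + f (2::3)"
  for f :: "3 \<Rightarrow> 'a::comm_monoid_add"
proof -
  have "(3::3) = 0" by simp
  then show ?thesis by (simp only: sum_3 ac_simps)
qed

lemma exp_third: "exp (2 * of_real pi * \<i> / 3) = Complex (-1/2) (sqrt 3 / 2)"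
proof -
  have "exp (2 * of_real pi * \<i> / 3) = cis (2 * pi / 3)"
    by (simp add: cis_conv_exp mult_ac)
  then show ?thesis
    by (simp add: cis.ctr cos_120 sin_120)
qed

lemma character_values:
  "character 0 = 1"
  "character 1 = exp (2 * of_real pi * \<i> / 3)"
  "character 2 = cnj (exp (2 * of_real pi * \<i> / 3))"
  unfolding character_def exp_third bit1.Rep_0 bit1.Rep_1 bit1.Rep_numeral
  by (simp_all add: complex_eq_iff power2_eq_square)

lemma character_add: "character (j + k) = character j * character k"
proof -
  have *: "(1::3) + 2 = 0" "(2::3) + 1 = 0" "(2::3) + 2 = 1" "(1::3) + 1 = 2" by simp_all
  show ?thesis
    using Z3_exhaust[of j] Z3_exhaust[of k]
    by (elim disjE; simp only: *; simp add: character_values exp_third complex_eq_iff)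
qed

lemma char_comb_values:
  defines "w \<equiv> Complex (-1/2) (sqrt 3 / 2)"
  shows "char_comb a0 a1 a2 0 = a0 + a1 + a2"
    "char_comb a0 a1 a2 1 = a0 + a1 * w + a2 * cnj w"
    "char_comb a0 a1 a2 2 = a0 + a1 * cnj w + a2 * w"
  by (simp_all add: char_comb_def character_values exp_third w_def)

lemma char_comb_coeffs:
  fixes a0 a1 a2 :: complex
  defines "w \<equiv> Complex (-1/2) (sqrt 3 / 2)" and "f \<equiv> char_comb a0 a1 a2"
  shows "a0 = (f 0 + f 1 + f 2) / 3"
    "a1 = (f 0 + cnj w * f 1 + w * f 2) / 3"
    "a2 = (f 0 + w * f 1 + cnj w * f 2) / 3"
  unfolding f_def char_comb_values w_def
  by (simp_all add: complex_eq_iff field_simps)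

lemma char_comb_inject:
  "char_comb a0 a1 a2 = char_comb b0 b1 b2 \<longleftrightarrow> a0 = b0 \<and> a1 = b1 \<and> a2 = b2"
  using char_comb_coeffs[where ?a0.0 = a0 and ?a1.0 = a1 and ?a2.0 = a2]
    char_comb_coeffs[where ?a0.0 = b0 and ?a1.0 = b1 and ?a2.0 = b2]
  by metis

lemma char_comb_exists: "\<exists>a0 a1 a2. f = char_comb a0 a1 a2"
proof -
  define w where "w = Complex (-1/2) (sqrt 3 / 2)"
  define a0 where "a0 = (f 0 + f 1 + f 2) / 3"
  define a1 where "a1 = (f 0 + cnj w * f 1 + w * f 2) / 3"
  define a2 where "a2 = (f 0 + w * f 1 + cnj w * f 2) / 3"
  have "f k = char_comb a0 a1 a2 k" for k
    using Z3_exhaust[of k]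
    by (elim disjE; simp add: char_comb_values a0_def a1_def a2_def w_def complex_eq_iff field_simps)
  then show ?thesis by blast
qed

lemma T_char_comb:
  "T r (char_comb a0 a1 a2) = char_comb a0 (of_real r * a1) (of_real r * a2)"
  unfolding T_def by (rule the_equality) (auto simp: char_comb_inject)

lemma Lp_norm_T_0_le:
  assumes "1 \<le> p" "0 < q"
  shows "Lp_norm q (T 0 f) \<le> Lp_norm p f"
proof -
  obtain a0 a1 a2 where f: "f = char_comb a0 a1 a2"
    using char_comb_exists by blast
  have T0: "T 0 f k = (\<Sum>k\<in>UNIV. f k) / 3" for k
    using char_comb_coeffs(1)[of a0 a1 a2]
    by (simp add: f T_char_comb sum_Z3) (simp add: char_comb_def)
  define y where "y = norm ((\<Sum>k\<in>UNIV. f k) / 3)"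
  have "Lp_norm q (T 0 f) = y"
    using assms(2) by (simp add: Lp_norm_def T0 powr_powr y_def)
  define x where "x k = norm (f k)" for k
  have "y \<le> (\<Sum>k\<in>UNIV. x k) / 3"
    using norm_sum[of f UNIV] by (simp add: y_def x_def norm_divide)
  have jensen: "(\<Sum>k\<in>UNIV. 1 / 3 * (x k + e)) powr p \<le> (\<Sum>k\<in>UNIV. 1 / 3 * (x k + e) powr p)"
    if "e > 0" for e
  proof -
    have "x k + e > 0" for k
      using that by (simp add: x_def add_nonneg_pos)
    then show ?thesis
      using convex_on_sum[OF _ _ powr_convex[OF assms(1)], of "UNIV :: 3 set" "\<lambda>_. 1 / 3" "\<lambda>k. x k + e"]
      by simp
  qed
  have "(\<Sum>k\<in>UNIV. 1 / 3 * (x k + 0)) powr p \<le> (\<Sum>k\<in>UNIV. 1 / 3 * (x k + 0) powr p)"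
  proof (rule tendsto_le)
    show "((\<lambda>e. \<Sum>k\<in>UNIV. 1 / 3 * (x k + e) powr p) \<longlongrightarrow> (\<Sum>k\<in>UNIV. 1 / 3 * (x k + 0) powr p)) (at_right 0)"
      using assms(1)
      by (intro tendsto_intros tendsto_powr')
         (auto simp: x_def eventually_at_filter intro!: always_eventually)
    show "((\<lambda>e. (\<Sum>k\<in>UNIV. 1 / 3 * (x k + e)) powr p) \<longlongrightarrow> (\<Sum>k\<in>UNIV. 1 / 3 * (x k + 0)) powr p) (at_right 0)"
      using assms(1)
      by (intro tendsto_intros tendsto_powr')
         (auto simp: x_def eventually_at_filter intro!: always_eventually sum_nonneg)
    show "\<forall>\<^sub>F e in at_right 0. (\<Sum>k\<in>UNIV. 1 / 3 * (x k + e)) powr p \<le> (\<Sum>k\<in>UNIV. 1 / 3 * (x k + e) powr p)"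
      using jensen by (auto simp: eventually_at_filter)
  qed simp
  then have "((\<Sum>k\<in>UNIV. x k) / 3) powr p \<le> 1 / 3 * (\<Sum>k\<in>UNIV. x k powr p)"
    by (simp add: sum_divide_distrib)
  then have "(((\<Sum>k\<in>UNIV. x k) / 3) powr p) powr (1 / p) \<le> (1 / 3 * (\<Sum>k\<in>UNIV. x k powr p)) powr (1 / p)"
    using assms(1) by (intro powr_mono2) auto
  moreover have "0 \<le> (\<Sum>k\<in>UNIV. x k) / 3"
    by (simp add: x_def sum_nonneg)
  ultimately have "(\<Sum>k\<in>UNIV. x k) / 3 \<le> Lp_norm p f"
    using assms(1) by (simp add: powr_powr Lp_norm_def x_def)
  then show ?thesis
    using \<open>Lp_norm q (T 0 f) = y\<close> \<open>y \<le> (\<Sum>k\<in>UNIV. x k) / 3\<close> by simp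
qed

lemma continuous_on_Lp_norm_T:
  assumes "0 < q"
  shows "continuous_on A (\<lambda>r. Lp_norm q (T r f))"
proof -
  obtain a0 a1 a2 where f: "f = char_comb a0 a1 a2"
    using char_comb_exists by blast
  have "continuous_on A (\<lambda>r. T r f k)" for k
    unfolding f T_char_comb unfolding char_comb_def by (intro continuous_intros)
  then have *: "continuous_on A (\<lambda>r. norm (T r f k) powr q)" for k
    using assms by (intro continuous_on_powr') (auto intro: continuous_intros)
  show ?thesis
    unfolding Lp_norm_def using assms
    by (intro continuous_on_powr' continuous_on_mult continuous_on_const continuous_on_sum[OF *])
       (auto intro: sum_nonneg)
qed

lemma r_crit_greatest:
  assumes "1 \<le> p" "0 < q"
  shows "0 \<le> r_crit p q" "r_crit p q \<le> 1"
    and "\<And>r f. 0 \<le> r \<Longrightarrow> r \<le> r_crit p q \<Longrightarrow> Lp_norm q (T r f) \<le> Lp_norm p f"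
    and "\<And>s. 0 \<le> s \<Longrightarrow> s \<le> 1 \<Longrightarrow>
      (\<And>r f. 0 \<le> r \<Longrightarrow> r \<le> s \<Longrightarrow> Lp_norm q (T r f) \<le> Lp_norm p f) \<Longrightarrow> s \<le> r_crit p q"
proof -
  define C where "C = (\<Inter>f. {r. Lp_norm q (T r f) \<le> Lp_norm p f})"
  define P where "P s \<longleftrightarrow> 0 \<le> s \<and> s \<le> 1 \<and>
     (\<forall>r. 0 \<le> r \<and> r \<le> s \<longrightarrow> (\<forall>f. Lp_norm q (T r f) \<le> Lp_norm p f))" for s
  have P_iff: "P s \<longleftrightarrow> 0 \<le> s \<and> s \<le> 1 \<and> {0..s} \<subseteq> C" for s
    by (auto simp: P_def C_def)
  have "closed C"
    unfolding C_def
    by (intro closed_INT ballI closed_Collect_le continuous_on_Lp_norm_T assms continuous_on_const)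
  have "P 0"
    using Lp_norm_T_0_le[OF assms] by (auto simp: P_def)
  define s0 where "s0 = Sup (Collect P)"
  have bdd: "bdd_above (Collect P)"
    by (rule bdd_aboveI[of _ 1]) (auto simp: P_def)
  have ub: "s \<le> s0" if "P s" for s
    unfolding s0_def using that bdd by (intro cSup_upper) auto
  have "s0 \<le> 1"
    unfolding s0_def by (rule cSup_least) (use \<open>P 0\<close> in blast, simp add: P_def)
  have "0 \<le> s0"
    using ub[OF \<open>P 0\<close>] .
  have "{0..<s0} \<subseteq> C"
  proof
    fix r assume r: "r \<in> {0..<s0}"
    then obtain s where "P s" "r < s"
      using less_cSup_iff[OF _ bdd, of r] \<open>P 0\<close> unfolding s0_def by auto
    then show "r \<in> C"
      using r by (auto simp: P_iff)
  qed
  have "{0..s0} \<subseteq> C"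
  proof (cases "s0 = 0")
    case True
    then show ?thesis using \<open>P 0\<close> by (simp add: P_iff)
  next
    case False
    then have "closure {0..<s0} = {0..s0}"
      using \<open>0 \<le> s0\<close> by simp
    then show ?thesis
      using closure_minimal[OF \<open>{0..<s0} \<subseteq> C\<close> \<open>closed C\<close>] by simp
  qed
  then have "P s0"
    using \<open>0 \<le> s0\<close> \<open>s0 \<le> 1\<close> by (simp add: P_iff)
  have "r_crit p q = s0"
    unfolding r_crit_def P_def[symmetric]
    using \<open>P s0\<close> ub by (rule Greatest_equality)
  with \<open>P s0\<close> ub show "0 \<le> r_crit p q" "r_crit p q \<le> 1"
    "\<And>r f. 0 \<le> r \<Longrightarrow> r \<le> r_crit p q \<Longrightarrow> Lp_norm q (T r f) \<le> Lp_norm p f"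
    "\<And>s. 0 \<le> s \<Longrightarrow> s \<le> 1 \<Longrightarrow>
      (\<And>r f. 0 \<le> r \<Longrightarrow> r \<le> s \<Longrightarrow> Lp_norm q (T r f) \<le> Lp_norm p f) \<Longrightarrow> s \<le> r_crit p q"
    unfolding P_def by blast+
qed

end

theory Submission
  imports Defs "HOL-Real_Asymp.Real_Asymp"
begin

text \<open>
  Let \<open>\<sigma> = sqrt ((p - 1) / (q - 1))\<close>. For \<open>r < \<sigma>\<close>, expanding \<open>|1 + z|\<^sup>p\<close> to second order shows
  that the inequality \<open>\<parallel>T\<^sub>r f\<parallel>\<^sub>q \<le> \<parallel>f\<parallel>\<^sub>p\<close> holds for all \<open>f\<close> in a neighbourhood of the constant 1, uniformly
  in \<open>r \<le> \<rho> < \<sigma>\<close>. At \<open>r = \<sigma>\<close> the second-order terms for real \<open>f\<close> cancel, but \<open>u = \<chi> + cnj \<chi>\<close> has a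
  positive third moment, and the third-order terms of \<open>1 + \<epsilon> u\<close> violate the inequality; hence the
  critical radius is less than \<open>\<sigma>\<close>. Violating functions for radii decreasing to the critical one,
  normalised in the space of coefficients, therefore accumulate at an extremizer, which cannot be
  constant by the uniform neighbourhood.
\<close>

section \<open>Failure of the inequality at the radius \<sigma>\<close>

text \<open>For small \<open>e\<close> the mean is the \<open>p\<close>-norm of
  \<open>1 + c e u\<close> with \<open>u = \<chi> + cnj \<chi>\<close>, which takes the values 2,
  -1, -1. The first three moments of \<open>u\<close> are 0, 2, 2, which produces the coefficients
  \<open>p - 1\<close> and \<open>(p - 1) * (p - 2) / 3\<close>. The scale \<open>c\<close> allows a
  function and its image under \<open>T\<close> to be expanded in the same variable
  \<open>e\<close>.\<close>

lemma powr_mean_third_order: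
  fixes p c :: real
  assumes "1 < p" "0 < c"
  shows "((\<lambda>e. ((((1 + 2 * (c * e)) powr p + 2 * (1 - c * e) powr p) / 3) powr (1 / p)
           - 1 - (p - 1) * (c * e)^2) / e^3) \<longlongrightarrow> c^3 * ((p - 1) * (p - 2) / 3)) (at_right 0)"
proof -
  have lim: "((\<lambda>e. ((((1 + 2 * e) powr p + 2 * (1 - e) powr p) / 3) powr (1 / p)
           - 1 - (p - 1) * e^2) / e^3) \<longlongrightarrow> (p - 1) * (p - 2) / 3) (at_right 0)"
    using assms(1) by real_asymp
  have "filterlim (\<lambda>e. c * e) (at_right 0) (at_right 0)"
    using assms(2) by real_asymp
  from tendsto_mult_left[OF filterlim_compose[OF lim this], of "c^3"] show ?thesis
    using assms(2) by (simp add: power_mult_distrib)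
qed

text \<open>On this range of \<open>e\<close> the three values \<open>1 + 2 * e\<close>,
  \<open>1 - e\<close>, \<open>1 - e\<close> are nonnegative, so the moduli disappear.\<close>

lemma Lp_norm_char_comb_real:
  fixes e :: real
  assumes "0 \<le> e" "e \<le> 1"
  shows "Lp_norm p (char_comb 1 (of_real e) (of_real e)) =
    (((1 + 2 * e) powr p + 2 * (1 - e) powr p) / 3) powr (1 / p)"
proof -
  have "char_comb 1 (of_real e) (of_real e) 0 = of_real (1 + 2 * e)"
    "char_comb 1 (of_real e) (of_real e) 1 = of_real (1 - e)"
    "char_comb 1 (of_real e) (of_real e) 2 = of_real (1 - e)"
    by (simp_all add: char_comb_values complex_eq_iff)
  then show ?thesis
    using assms by (simp only: Lp_norm_def sum_Z3 norm_of_real) (simp add: add.commute)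
qed

text \<open>The witnesses are \<open>1 + e (\<chi> + cnj \<chi>)\<close> with small
  \<open>e > 0\<close>. At this radius the quadratic coefficients \<open>p - 1\<close> and
  \<open>r^2 * (q - 1)\<close> agree, so the cubic ones decide, and their comparison reduces to
  \<open>p - 2 < (q - 2) * r\<close>.\<close>

lemma Lp_norm_less_T_sqrt:
  fixes p q :: real
  assumes "1 < p" "p < q"
  shows "\<exists>f. Lp_norm p f < Lp_norm q (T (sqrt ((p - 1) / (q - 1))) f)"
proof -
  define r where "r = sqrt ((p - 1) / (q - 1))"
  define G :: "real \<Rightarrow> real \<Rightarrow> real"
    where "G s e = (((1 + 2 * e) powr s + 2 * (1 - e) powr s) / 3) powr (1 / s)" for s e
  have r: "0 < r" "r < 1" and r2: "r^2 * (q - 1) = p - 1"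
    using assms by (simp_all add: r_def)
  \<comment> \<open>\<open>(x - 2) / sqrt (x - 1)\<close> is strictly increasing in \<open>x\<close>\<close>
  have "p - 2 < (q - 2) * r"
  proof -
    \<comment> \<open>In the variable \<open>y = sqrt (x - 1)\<close> the quotient
      \<open>(x - 2) / sqrt (x - 1)\<close> is \<open>y - 1/y\<close>.\<close>
    define a where "a = sqrt (p - 1)"
    define b where "b = sqrt (q - 1)"
    have ab: "0 < a" "a < b" "p = a^2 + 1" "q = b^2 + 1" "r = a / b"
      using assms by (simp_all add: a_def b_def r_def real_sqrt_divide)
    have "(b^2 - 1) * a - (a^2 - 1) * b = (b - a) * (a * b + 1)"
      by (simp add: power2_eq_square algebra_simps)
    then have "(a^2 - 1) * b < (b^2 - 1) * a"
      using ab by (smt (verit) mult_pos_pos)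
    moreover have "p - 2 = a^2 - 1" "(q - 2) * r = (b^2 - 1) * a / b" "0 < b"
      using ab by auto
    ultimately show ?thesis
      by (simp only: pos_less_divide_eq)
  qed
  then have "(p - 1) * (p - 2) < (p - 1) * ((q - 2) * r)"
    using assms by simp
  also have "\<dots> = r^3 * ((q - 1) * (q - 2))"
    by (simp add: r2[symmetric] power2_eq_square power3_eq_cube)
  finally have lt: "1^3 * ((p - 1) * (p - 2) / 3) < r^3 * ((q - 1) * (q - 2) / 3)"
    by simp
  have "((\<lambda>e. (G p (1 * e) - 1 - (p - 1) * (1 * e)^2) / e^3) \<longlongrightarrow> 1^3 * ((p - 1) * (p - 2) / 3)) (at_right 0)"
    unfolding G_def using assms by (intro powr_mean_third_order) auto
  moreover have "((\<lambda>e. (G q (r * e) - 1 - (q - 1) * (r * e)^2) / e^3) \<longlongrightarrow> r^3 * ((q - 1) * (q - 2) / 3)) (at_right 0)"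
    unfolding G_def using assms r by (intro powr_mean_third_order) auto
  ultimately have "((\<lambda>e. (G q (r * e) - 1 - (q - 1) * (r * e)^2) / e^3 - (G p (1 * e) - 1 - (p - 1) * (1 * e)^2) / e^3)
      \<longlongrightarrow> r^3 * ((q - 1) * (q - 2) / 3) - 1^3 * ((p - 1) * (p - 2) / 3)) (at_right 0)"
    by (intro tendsto_diff)
  then have "\<forall>\<^sub>F e in at_right 0. 0 <
      (G q (r * e) - 1 - (q - 1) * (r * e)^2) / e^3 - (G p (1 * e) - 1 - (p - 1) * (1 * e)^2) / e^3"
    using lt by (intro order_tendstoD(1)) auto
  moreover have "\<forall>\<^sub>F e in at_right 0. 0 < e \<and> e < (1::real)"
    unfolding eventually_at_right_field by (intro exI[of _ 1]) auto
  ultimately obtain e where "0 < e" "e < 1"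
    and "0 < (G q (r * e) - 1 - (q - 1) * (r * e)^2) / e^3 - (G p (1 * e) - 1 - (p - 1) * (1 * e)^2) / e^3"
    using eventually_happens'[OF trivial_limit_at_right_real eventually_conj] by blast
  \<comment> \<open>The subtracted quadratic terms coincide, so the sign of the difference of
    quotients is that of \<open>G q (r * e) - G p e\<close>.\<close>
  moreover have "(q - 1) * (r * e)^2 = (p - 1) * e^2"
    by (simp add: r2[symmetric] power_mult_distrib)
  ultimately have "G p e < G q (r * e)"
    by (simp add: divide_less_cancel)
  moreover have "r * e \<le> 1" "0 \<le> r * e"
    using \<open>0 < e\<close> \<open>e < 1\<close> r by (auto intro: mult_le_one)
  ultimately have "Lp_norm p (char_comb 1 (of_real e) (of_real e))
      < Lp_norm q (T r (char_comb 1 (of_real e) (of_real e)))"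
    using \<open>0 < e\<close> \<open>e < 1\<close> Lp_norm_char_comb_real[of e p] Lp_norm_char_comb_real[of "r * e" q]
    by (simp add: T_char_comb G_def)
  then show ?thesis
    unfolding r_def by blast
qed

section \<open>Second-order expansion of powers of the modulus near 1\<close>

text \<open>Peano form of Taylor's theorem at 0. The bound \<open>\<delta> < 1\<close> later ensures
  \<open>|z|^2 \<le> |z|\<close>.\<close>

lemma powr_second_order:
  fixes s \<eta> :: real
  assumes "0 < \<eta>"
  shows "\<exists>\<delta>>0. \<delta> < 1 \<and> (\<forall>w. \<bar>w\<bar> \<le> \<delta> \<longrightarrow>
    \<bar>(1 + w) powr s - 1 - s * w - s * (s - 1) / 2 * w^2\<bar> \<le> \<eta> * w^2)"
proof -
  have "((\<lambda>w. ((1 + w) powr s - 1 - s * w - s * (s - 1) / 2 * w^2) / w^2) \<longlongrightarrow> 0) (at 0)"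
    by real_asymp
  then have "\<forall>\<^sub>F w in at 0. dist (((1 + w) powr s - 1 - s * w - s * (s - 1) / 2 * w^2) / w^2) 0 < \<eta>"
    using assms by (rule tendstoD)
  then obtain d where "0 < d" and d: "\<And>w. w \<noteq> 0 \<Longrightarrow> \<bar>w\<bar> < d \<Longrightarrow>
      \<bar>((1 + w) powr s - 1 - s * w - s * (s - 1) / 2 * w^2) / w^2\<bar> < \<eta>"
    unfolding eventually_at by (auto simp: dist_real_def)
  have "\<bar>(1 + w) powr s - 1 - s * w - s * (s - 1) / 2 * w^2\<bar> \<le> \<eta> * w^2"
    if "\<bar>w\<bar> \<le> min (d / 2) (1 / 2)" for w
  proof (cases "w = 0")
    case False
    then show ?thesis
      using d[of w] that \<open>0 < d\<close> by (simp add: abs_divide divide_less_eq)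
  qed simp
  then show ?thesis
    using \<open>0 < d\<close> by (intro exI[of _ "min (d / 2) (1 / 2)"]) auto
qed

text \<open>Since \<open>|1 + z|^2 = 1 + w\<close> with \<open>w = 2 Re z + |z|^2\<close>, the left
  power is \<open>(1 + w) powr (p / 2)\<close>, and the real expansion applies. Real perturbations
  get weight \<open>p - 1\<close>, imaginary ones weight 1.\<close>

lemma norm_powr_second_order:
  fixes p \<eta> :: real
  assumes "0 < \<eta>"
  shows "\<exists>\<delta>>0. \<forall>z::complex. norm z \<le> \<delta> \<longrightarrow>
    \<bar>norm (1 + z) powr p - 1 - p * Re z - p / 2 * ((p - 1) * (Re z)^2 + (Im z)^2)\<bar> \<le> \<eta> * (norm z)^2"
proof -
  define s where "s = p / 2"
  define K where "K = \<bar>s * (s - 1) / 2\<bar>"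
  obtain d where d: "0 < d" "d < 1" and dw: "\<And>w. \<bar>w\<bar> \<le> d \<Longrightarrow>
      \<bar>(1 + w) powr s - 1 - s * w - s * (s - 1) / 2 * w^2\<bar> \<le> \<eta> / 18 * w^2"
    \<comment> \<open>From \<open>|w| \<le> 3 |z|\<close> the error is at most
      \<open>\<eta> / 18 * 9 |z|^2\<close>, half of the allowance.\<close>
    using powr_second_order[of "\<eta> / 18" s] assms by (metis zero_less_divide_iff zero_less_numeral)
  \<comment> \<open>The first bound gives \<open>|w| \<le> d\<close>; the second keeps the cubic
    remainder, at most \<open>5 K |z|^3\<close>, within the other half of the allowance.\<close>
  define \<delta> where "\<delta> = min (d / 3) (\<eta> / (10 * (K + 1)))"
  have "K \<ge> 0" by (simp add: K_def)
  have "\<bar>norm (1 + z) powr p - 1 - p * Re z - p / 2 * ((p - 1) * (Re z)^2 + (Im z)^2)\<bar> \<le> \<eta> * (norm z)^2"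
    if z: "norm z \<le> \<delta>" for z :: complex
  proof -
    define n where "n = norm z"
    define w where "w = 2 * Re z + n^2"
    have n: "0 \<le> n" "n \<le> d / 3" "n \<le> 1" "n \<le> \<eta> / (10 * (K + 1))"
      using z d by (auto simp: n_def \<delta>_def)
    have n2: "n^2 = (Re z)^2 + (Im z)^2"
      by (simp add: n_def cmod_power2)
    have nn: "n^2 \<le> n"
      using n by (simp add: power2_eq_square mult_left_le)
    have Re: "\<bar>Re z\<bar> \<le> n"
      by (simp add: n_def abs_Re_le_cmod)
    have w3: "\<bar>w\<bar> \<le> 3 * n"
      unfolding w_def using nn Re n zero_le_power2[of n] by linarith
    have "norm (1 + z)^2 = 1 + w"
      unfolding cmod_power2 w_def n2 by (simp add: power2_eq_square algebra_simps)
    then have "norm (1 + z) powr p = (1 + w) powr s"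
      by (cases "1 + z = 0") (simp_all add: s_def powr_powr flip: powr_numeral \<open>norm (1 + z)^2 = 1 + w\<close>)
    moreover have "\<bar>(1 + w) powr s - 1 - s * w - s * (s - 1) / 2 * w^2\<bar> \<le> \<eta> / 2 * n^2"
    proof -
      have "w^2 \<le> (3 * n)^2"
        using w3 by (metis abs_ge_zero power2_abs power_mono)
      then have "\<eta> / 18 * w^2 \<le> \<eta> / 18 * (3 * n)^2"
        using assms by (intro mult_left_mono) auto
      then show ?thesis
        using dw[of w] w3 n by (simp add: power_mult_distrib)
    qed
    moreover have "\<bar>s * (s - 1) / 2 * (n^2 * (4 * Re z + n^2))\<bar> \<le> \<eta> / 2 * n^2"
    proof -
      have "\<bar>4 * Re z + n^2\<bar> \<le> 5 * n"
        using nn Re n by (smt (verit) zero_le_power2)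
      then have "K * \<bar>4 * Re z + n^2\<bar> \<le> (K + 1) * (5 * n)"
        using \<open>K \<ge> 0\<close> n by (intro mult_mono) auto
      also have "\<dots> \<le> \<eta> / 2"
        using n(4) \<open>K \<ge> 0\<close> by (simp add: field_simps)
      finally have "K * \<bar>4 * Re z + n^2\<bar> * n^2 \<le> \<eta> / 2 * n^2"
        by (intro mult_right_mono) auto
      then show ?thesis
        by (simp add: K_def abs_mult mult_ac)
    qed
    \<comment> \<open>The expansion in \<open>w\<close> contains
      \<open>w^2 = 4 (Re z)^2 + n^2 * (4 * Re z + n^2)\<close>; only its first summand belongs to
      the quadratic form in \<open>z\<close>.\<close>
    moreover have "(1 + w) powr s - 1 - p * Re z - p / 2 * ((p - 1) * (Re z)^2 + (Im z)^2) =
       ((1 + w) powr s - 1 - s * w - s * (s - 1) / 2 * w^2) + s * (s - 1) / 2 * (n^2 * (4 * Re z + n^2))"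
    proof -
      have "p = 2 * s" by (simp add: s_def)
      moreover have "(Im z)^2 = n^2 - (Re z)^2" by (simp add: n2)
      ultimately show ?thesis
        by (simp only:) (simp add: w_def power2_eq_square field_simps)
    qed
    ultimately show ?thesis
      unfolding n_def[symmetric] by linarith
  qed
  moreover have "\<delta> > 0"
    using d assms \<open>K \<ge> 0\<close> by (simp add: \<delta>_def)
  ultimately show ?thesis by blast
qed

lemma sum_character: "(\<Sum>k\<in>UNIV. character k) = 0"
  by (simp add: sum_Z3 character_values exp_third complex_eq_iff)

lemma norm_character: "norm (character k) = 1"
  by (simp add: character_def norm_power norm_exp_eq_Re)

text \<open>The pointwise expansions are added up; the linear terms cancel because the perturbation
  has sum zero.\<close>

lemma sum_norm_powr_second_order:
  fixes p \<eta> :: real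
  assumes "0 < \<eta>"
  shows "\<exists>\<delta>>0. \<forall>z :: 'a::finite \<Rightarrow> complex. (\<forall>k. norm (z k) \<le> \<delta>) \<longrightarrow> (\<Sum>k\<in>UNIV. z k) = 0 \<longrightarrow>
    \<bar>(\<Sum>k\<in>UNIV. norm (1 + z k) powr p - 1) - p / 2 * ((p - 1) * (\<Sum>k\<in>UNIV. (Re (z k))^2) + (\<Sum>k\<in>UNIV. (Im (z k))^2))\<bar>
      \<le> \<eta> * (\<Sum>k\<in>UNIV. (norm (z k))^2)"
proof -
  obtain \<delta> where "0 < \<delta>" and \<delta>: "\<And>z::complex. norm z \<le> \<delta> \<Longrightarrow>
    \<bar>norm (1 + z) powr p - 1 - p * Re z - p / 2 * ((p - 1) * (Re z)^2 + (Im z)^2)\<bar> \<le> \<eta> * (norm z)^2"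
    using norm_powr_second_order[OF assms] by metis
  have "\<bar>(\<Sum>k\<in>UNIV. norm (1 + z k) powr p - 1) - p / 2 * ((p - 1) * (\<Sum>k\<in>UNIV. (Re (z k))^2) + (\<Sum>k\<in>UNIV. (Im (z k))^2))\<bar>
      \<le> \<eta> * (\<Sum>k\<in>UNIV. (norm (z k))^2)"
    if z: "\<And>k. norm (z k) \<le> \<delta>" and z0: "(\<Sum>k\<in>UNIV. z k) = 0" for z :: "'a \<Rightarrow> complex"
  proof -
    have "(\<Sum>k\<in>UNIV. p * Re (z k)) = p * Re (\<Sum>k\<in>UNIV. z k)"
      by (simp add: sum_distrib_left)
    also have "\<dots> = 0" by (simp add: z0)
    finally have "(\<Sum>k\<in>UNIV. p * Re (z k)) = 0" .
    moreover have "(\<Sum>k\<in>UNIV. p / 2 * ((p - 1) * (Re (z k))^2 + (Im (z k))^2)) =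
        p / 2 * ((p - 1) * (\<Sum>k\<in>UNIV. (Re (z k))^2) + (\<Sum>k\<in>UNIV. (Im (z k))^2))"
      by (simp only: sum_distrib_left[symmetric] sum.distrib)
    ultimately have "(\<Sum>k\<in>UNIV. norm (1 + z k) powr p - 1) - p / 2 * ((p - 1) * (\<Sum>k\<in>UNIV. (Re (z k))^2) + (\<Sum>k\<in>UNIV. (Im (z k))^2))
      = (\<Sum>k\<in>UNIV. norm (1 + z k) powr p - 1 - p * Re (z k) - p / 2 * ((p - 1) * (Re (z k))^2 + (Im (z k))^2))"
      by (simp only: sum_subtractf)
    also have "\<bar>\<dots>\<bar> \<le> (\<Sum>k\<in>UNIV. \<eta> * (norm (z k))^2)"
      by (rule order_trans[OF sum_abs]) (intro sum_mono \<delta> z)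
    finally show ?thesis
      by (simp add: sum_distrib_left)
  qed
  with \<open>0 < \<delta>\<close> show ?thesis by blast
qed

section \<open>The inequality near constants, uniformly in the radius\<close>

text \<open>The difference quotient at 0 tends to \<open>s\<close>, so a slope slightly above
  \<open>s\<close> suffices. Together with \<open>Bernoulli_powr\<close> this replaces expanding the
  outer powers \<open>1 / p\<close> and \<open>1 / q\<close>.\<close>

lemma one_plus_powr_le_linear:
  fixes s \<kappa> :: real
  assumes "0 < \<kappa>"
  shows "\<exists>\<delta>>0. \<forall>x. 0 \<le> x \<longrightarrow> x \<le> \<delta> \<longrightarrow> (1 + x) powr s \<le> 1 + (s + \<kappa>) * x"
proof -
  have "((\<lambda>x. ((1 + x) powr s - 1) / x) \<longlongrightarrow> s) (at_right 0)"
    by real_asymp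
  then have "\<forall>\<^sub>F x in at_right 0. ((1 + x) powr s - 1) / x < s + \<kappa>"
    using assms by (intro order_tendstoD(2)) auto
  then obtain d where "0 < d" and d: "\<And>x. 0 < x \<Longrightarrow> x < d \<Longrightarrow> ((1 + x) powr s - 1) / x < s + \<kappa>"
    unfolding eventually_at_right_field by auto
  have "(1 + x) powr s \<le> 1 + (s + \<kappa>) * x" if "0 \<le> x" "x \<le> d / 2" for x
    using d[of x] that \<open>0 < d\<close> by (cases "x = 0") (simp_all add: field_simps)
  then show ?thesis
    using \<open>0 < d\<close> by (intro exI[of _ "d / 2"]) auto
qed

text \<open>The difference \<open>(1 + t) powr s - s * t\<close> has nonnegative derivative for
  \<open>t \<ge> 0\<close>.\<close>

lemma Bernoulli_powr:
  fixes x s :: real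
  assumes "1 \<le> s" "0 \<le> x"
  shows "1 + s * x \<le> (1 + x) powr s"
proof -
  define g where "g t = (1 + t) powr s - s * t" for t
  have "g 0 \<le> g x"
  proof (rule DERIV_nonneg_imp_nondecreasing[OF assms(2)])
    fix t assume "0 \<le> t" "t \<le> x"
    then have "(g has_real_derivative s * (1 + t) powr (s - 1) - s) (at t)"
      unfolding g_def by (auto intro!: derivative_eq_intros)
    moreover have "1 \<le> (1 + t) powr (s - 1)"
      using assms(1) \<open>0 \<le> t\<close> by (intro ge_one_powr_ge_zero) auto
    then have "0 \<le> s * (1 + t) powr (s - 1) - s"
      using assms(1) by simp
    ultimately show "\<exists>y. (g has_real_derivative y) (at t) \<and> 0 \<le> y"
      by blast
  qed
  then show ?thesis by (simp add: g_def)
qed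

text \<open>With \<open>U\<close> and \<open>V\<close> the sums of squared real and imaginary parts,
  the quadratic form \<open>r^2 * ((q - 1) * U + V)\<close> stays below
  \<open>(p - 1) * U + V\<close> by a margin proportional to \<open>U + V\<close>, because
  \<open>\<rho>^2 * (q - 1) < p - 1\<close> and \<open>\<rho>^2 < 1\<close>. This margin absorbs all
  errors.\<close>

lemma Lp_norm_T_le_near_const:
  fixes p q \<rho> :: real
  assumes pq: "1 < p" "p < q" and \<rho>: "0 \<le> \<rho>" "\<rho> < sqrt ((p - 1) / (q - 1))"
  shows "\<exists>\<delta>>0. \<forall>r b c. 0 \<le> r \<longrightarrow> r \<le> \<rho> \<longrightarrow> norm b \<le> \<delta> \<longrightarrow> norm c \<le> \<delta> \<longrightarrow>
    Lp_norm q (T r (char_comb 1 b c)) \<le> Lp_norm p (char_comb 1 b c)"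
proof -
  have "\<rho>^2 < (sqrt ((p - 1) / (q - 1)))^2"
    using \<rho> by (intro power_strict_mono) auto
  then have \<rho>2: "\<rho>^2 < (p - 1) / (q - 1)"
    using pq by simp
  moreover have "(p - 1) / (q - 1) < 1"
    using pq by simp
  ultimately have \<rho>1: "\<rho>^2 < 1" by linarith
  have \<rho>q: "\<rho>^2 * (q - 1) < p - 1"
    using \<rho>2 pq by (simp add: pos_less_divide_eq)
  \<comment> \<open>One third of the smaller gap, as there are three losses: the errors of the
    \<open>q\<close>- and \<open>p\<close>-expansions and the enlarged slope
    \<open>p + \<kappa>\<close>.\<close>
  define \<kappa> where "\<kappa> = min ((p - 1 - \<rho>^2 * (q - 1)) / 3) ((1 - \<rho>^2) / 3)"
  have \<kappa>: "0 < \<kappa>" "\<rho>^2 * (q - 1) + 3 * \<kappa> \<le> p - 1" "\<rho>^2 + 3 * \<kappa> \<le> 1"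
  proof -
    have "\<kappa> \<le> (p - 1 - \<rho>^2 * (q - 1)) / 3" "\<kappa> \<le> (1 - \<rho>^2) / 3"
      unfolding \<kappa>_def by (rule min.cobounded1, rule min.cobounded2)
    then show "\<rho>^2 * (q - 1) + 3 * \<kappa> \<le> p - 1" and "\<rho>^2 + 3 * \<kappa> \<le> 1"
      by (simp_all only: pos_le_divide_eq zero_less_numeral)
  qed (use \<rho>q \<rho>1 in \<open>simp add: \<kappa>_def\<close>)
  obtain \<delta>p where "0 < \<delta>p" and \<delta>p: "\<And>z :: 3 \<Rightarrow> complex. (\<And>k. norm (z k) \<le> \<delta>p) \<Longrightarrow> (\<Sum>k\<in>UNIV. z k) = 0 \<Longrightarrow>
    \<bar>(\<Sum>k\<in>UNIV. norm (1 + z k) powr p - 1) - p / 2 * ((p - 1) * (\<Sum>k\<in>UNIV. (Re (z k))^2) + (\<Sum>k\<in>UNIV. (Im (z k))^2))\<bar>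
      \<le> p / 2 * \<kappa> * (\<Sum>k\<in>UNIV. (norm (z k))^2)"
    using sum_norm_powr_second_order[of "p / 2 * \<kappa>" p, where ?'a = 3] \<kappa> pq by fastforce
  obtain \<delta>q where "0 < \<delta>q" and \<delta>q: "\<And>z :: 3 \<Rightarrow> complex. (\<And>k. norm (z k) \<le> \<delta>q) \<Longrightarrow> (\<Sum>k\<in>UNIV. z k) = 0 \<Longrightarrow>
    \<bar>(\<Sum>k\<in>UNIV. norm (1 + z k) powr q - 1) - q / 2 * ((q - 1) * (\<Sum>k\<in>UNIV. (Re (z k))^2) + (\<Sum>k\<in>UNIV. (Im (z k))^2))\<bar>
      \<le> q / 2 * \<kappa> * (\<Sum>k\<in>UNIV. (norm (z k))^2)"
    using sum_norm_powr_second_order[of "q / 2 * \<kappa>" q, where ?'a = 3] \<kappa> pq by fastforce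
  obtain d where "0 < d" and d: "\<And>x. 0 \<le> x \<Longrightarrow> x \<le> d \<Longrightarrow> (1 + x) powr p \<le> 1 + (p + \<kappa>) * x"
    using one_plus_powr_le_linear[OF \<kappa>(1)] by metis
  \<comment> \<open>The perturbation has modulus at most \<open>2 * \<delta>\<close>, hence the
    halves; the last two bounds give \<open>\<delta>^2 \<le> d / (2 * p)\<close>, from which
    \<open>B / 2 \<le> d\<close>.\<close>
  define \<delta> where "\<delta> = min (min (\<delta>p / 2) (\<delta>q / 2)) (min 1 (d / (2 * p)))"
  have "0 < \<delta>"
    using \<open>0 < \<delta>p\<close> \<open>0 < \<delta>q\<close> \<open>0 < d\<close> pq by (simp add: \<delta>_def)
  have "Lp_norm q (T r (char_comb 1 b c)) \<le> Lp_norm p (char_comb 1 b c)"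
    if r: "0 \<le> r" "r \<le> \<rho>" and b: "norm b \<le> \<delta>" and c: "norm c \<le> \<delta>" for r b c
  proof -
    define z where "z k = b * character k + c * cnj (character k)" for k
    have f: "char_comb 1 b c = (\<lambda>k. 1 + z k)" "T r (char_comb 1 b c) = (\<lambda>k. 1 + of_real r * z k)"
      unfolding T_char_comb by (auto simp: char_comb_def z_def algebra_simps)
    have "(\<Sum>k\<in>UNIV. z k) = b * (\<Sum>k\<in>UNIV. character k) + c * cnj (\<Sum>k\<in>UNIV. character k)"
      by (simp add: z_def sum.distrib sum_distrib_left)
    then have z0: "(\<Sum>k\<in>UNIV. z k) = 0"
      by (simp add: sum_character)
    have z2: "norm (z k) \<le> 2 * \<delta>" for k
      using norm_triangle_ineq[of "b * character k" "c * cnj (character k)"] b c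
      by (simp add: z_def norm_mult norm_character)
    have \<rho>_le: "\<rho>^2 \<le> 1" "r^2 \<le> \<rho>^2"
      using \<rho>1 r by (auto intro: power_mono)
    then have "r \<le> 1"
      using r by (metis abs_of_nonneg abs_square_le_1 order_trans)
    have rz: "norm (of_real r * z k) \<le> norm (z k)" for k
      using \<open>r \<le> 1\<close> r by (simp add: norm_mult mult_left_le_one_le)
    define U where "U = (\<Sum>k\<in>UNIV. (Re (z k))^2)"
    define V where "V = (\<Sum>k\<in>UNIV. (Im (z k))^2)"
    have N: "(\<Sum>k\<in>UNIV. (norm (z k))^2) = U + V"
      by (simp add: U_def V_def cmod_power2 sum.distrib)
    have UV: "0 \<le> U" "0 \<le> V"
      by (simp_all add: U_def V_def sum_nonneg)
    \<comment> \<open>The number \<open>1 + B / 2\<close> will separate the two norms: its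
      \<open>q\<close>-th power dominates the \<open>q\<close>-mean of \<open>T r f\<close>, and its
      \<open>p\<close>-th power is dominated by the \<open>p\<close>-mean of
      \<open>f\<close>.\<close>
    define B where "B = ((p - 1) * U + V - 2 * \<kappa> * (U + V)) / 3"
    have "p / 2 * ((p - 1) * U + V) - p / 2 * \<kappa> * (U + V) \<le> (\<Sum>k\<in>UNIV. norm (1 + z k) powr p - 1)"
    proof -
      have "norm (z k) \<le> \<delta>p" for k
        using z2[of k] by (simp add: \<delta>_def)
      from \<delta>p[OF this z0] show ?thesis
        unfolding N U_def[symmetric] V_def[symmetric] by linarith
    qed
    moreover have "p / 2 * ((p - 1) * U + V) - p / 2 * \<kappa> * (U + V) = p / 2 * ((p - 1) * U + V - \<kappa> * (U + V))"
      by (simp only: right_diff_distrib mult.assoc)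
    ultimately have P: "1 + p / 2 * ((p - 1) * U + V - \<kappa> * (U + V)) / 3 \<le> 1 / 3 * (\<Sum>k\<in>UNIV. norm (1 + z k) powr p)"
      by (simp add: sum_subtractf)
    have "(\<Sum>k\<in>UNIV. norm (1 + of_real r * z k) powr q - 1) \<le> q / 2 * ((q - 1) * (r^2 * U) + r^2 * V) + q / 2 * \<kappa> * (r^2 * (U + V))"
    proof -
      have small: "norm (of_real r * z k) \<le> \<delta>q" for k
        using z2[of k] rz[of k] by (simp add: \<delta>_def)
      have mean: "(\<Sum>k\<in>UNIV. of_real r * z k) = 0"
        by (simp add: z0 flip: sum_distrib_left)
      have moments: "(\<Sum>k\<in>UNIV. (Re (of_real r * z k))^2) = r^2 * U"
        "(\<Sum>k\<in>UNIV. (Im (of_real r * z k))^2) = r^2 * V"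
        "(\<Sum>k\<in>UNIV. (norm (of_real r * z k))^2) = r^2 * (U + V)"
        by (simp_all add: U_def V_def norm_mult power_mult_distrib sum_distrib_left)
          (simp add: cmod_power2 distrib_left sum.distrib sum_distrib_left)
      from \<delta>q[OF small mean] show ?thesis
        unfolding moments by linarith
    qed
    also have "\<dots> = q / 2 * ((r^2 * (q - 1) + r^2 * \<kappa>) * U + (r^2 + r^2 * \<kappa>) * V)"
      by (simp add: algebra_simps)
    also have "\<dots> \<le> q / 2 * ((p - 1 - 2 * \<kappa>) * U + (1 - 2 * \<kappa>) * V)"
    proof -
      have "r^2 * (q - 1) \<le> \<rho>^2 * (q - 1)" "r^2 * \<kappa> \<le> 1 * \<kappa>"
        using \<rho>_le pq \<kappa>(1) by (auto intro!: mult_right_mono)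
      then have "r^2 * (q - 1) + r^2 * \<kappa> \<le> p - 1 - 2 * \<kappa>" "r^2 + r^2 * \<kappa> \<le> 1 - 2 * \<kappa>"
        using \<kappa> \<rho>_le by linarith+
      then show ?thesis
        using pq UV by (intro mult_left_mono add_mono mult_right_mono) auto
    qed
    also have "\<dots> = 3 * (q / 2 * B)"
      by (simp add: B_def algebra_simps)
    finally have Q: "1 / 3 * (\<Sum>k\<in>UNIV. norm (1 + of_real r * z k) powr q) \<le> 1 + q * (B / 2)"
      by (simp add: sum_subtractf)
    have "0 \<le> (p - 1 - 2 * \<kappa>) * U + (1 - 2 * \<kappa>) * V"
    proof -
      have "0 \<le> \<rho>^2 * (q - 1)" using pq by simp
      then have "0 \<le> p - 1 - 2 * \<kappa>" "0 \<le> 1 - 2 * \<kappa>"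
        using \<kappa> zero_le_power2[of \<rho>] by linarith+
      then show ?thesis
        using UV by simp
    qed
    then have B0: "0 \<le> B"
      by (simp add: B_def algebra_simps)
    have pU: "(p - 1) * U + V \<le> p * (U + V)"
      using pq UV mult_right_mono[of 1 p V] by (simp add: algebra_simps)
    have "Lp_norm q (T r (char_comb 1 b c)) \<le> (1 + q * (B / 2)) powr (1 / q)"
      unfolding f(2) Lp_norm_def using Q pq by (intro powr_mono2) (auto intro: sum_nonneg)
    also have "\<dots> \<le> ((1 + B / 2) powr q) powr (1 / q)"
      using Bernoulli_powr[of q "B / 2"] pq B0 by (intro powr_mono2) auto
    also have "\<dots> = ((1 + B / 2) powr p) powr (1 / p)"
      using pq B0 by (simp add: powr_powr)
    also have "\<dots> \<le> Lp_norm p (char_comb 1 b c)"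
      unfolding f(1) Lp_norm_def
    proof (rule powr_mono2)
      have "U + V \<le> (\<Sum>k\<in>(UNIV::3 set). (2 * \<delta>)^2)"
        unfolding N[symmetric] using z2 by (intro sum_mono power_mono) auto
      also have "\<dots> = 12 * (\<delta> * \<delta>)"
        by (simp add: power2_eq_square)
      also have "\<dots> \<le> 12 * (1 * (d / (2 * p)))"
        using \<open>0 < \<delta>\<close> by (intro mult_left_mono mult_mono) (auto simp: \<delta>_def)
      finally have "p * (U + V) \<le> 6 * d"
        using pq by (simp add: field_simps)
      moreover have "0 \<le> \<kappa> * (U + V)"
        using \<kappa> UV by simp
      ultimately have "B / 2 \<le> d"
        using pU by (simp add: B_def)
      then have "(1 + B / 2) powr p \<le> 1 + (p + \<kappa>) * (B / 2)"
        using B0 by (intro d) auto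
      also have "\<dots> \<le> 1 + p / 2 * ((p - 1) * U + V - \<kappa> * (U + V)) / 3"
      proof -
        have "\<kappa> * ((p - 1) * U + V) \<le> \<kappa> * (p * (U + V))"
          using pU \<kappa> by (intro mult_left_mono) auto
        moreover have "0 \<le> \<kappa> * (\<kappa> * (U + V))"
          using UV \<kappa> by simp
        \<comment> \<open>With \<open>M\<close> the quadratic form and \<open>N = U + V\<close>, the
          slope loss \<open>\<kappa> * M\<close> is paid for by the spare
          \<open>p * \<kappa> * N\<close>, as \<open>M \<le> p * N\<close>.\<close>
        moreover have "(p + \<kappa>) * (M - 2 * \<kappa> * N) \<le> p * (M - \<kappa> * N)"
          if "\<kappa> * M \<le> \<kappa> * (p * N)" "0 \<le> \<kappa> * (\<kappa> * N)" for M N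
          using that by (simp add: algebra_simps)
        ultimately have "(p + \<kappa>) * ((p - 1) * U + V - 2 * \<kappa> * (U + V)) \<le> p * ((p - 1) * U + V - \<kappa> * (U + V))"
          by blast
        moreover have "(p + \<kappa>) * (B / 2) = (p + \<kappa>) * ((p - 1) * U + V - 2 * \<kappa> * (U + V)) / 6"
          by (simp add: B_def)
        ultimately show ?thesis
          by linarith
      qed
      also note P
      finally show "(1 + B / 2) powr p \<le> 1 / 3 * (\<Sum>k\<in>UNIV. norm (1 + z k) powr p)" .
    qed (use pq in auto)
    finally show ?thesis .
  qed
  with \<open>0 < \<delta>\<close> show ?thesis by blast
qed

section \<open>Continuity and scaling in the space of coefficients\<close>

lemma tendsto_Lp_norm_char_comb:
  assumes "0 < p" "(a \<longlongrightarrow> a') F" "(b \<longlongrightarrow> b') F" "(c \<longlongrightarrow> c') F"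
  shows "((\<lambda>x. Lp_norm p (char_comb (a x) (b x) (c x))) \<longlongrightarrow> Lp_norm p (char_comb a' b' c')) F"
  unfolding Lp_norm_def char_comb_def using assms
  by (intro tendsto_intros tendsto_powr') (auto intro!: sum_nonneg always_eventually)

text \<open>Violating functions are rescaled twice: onto the unit sphere of coefficient triples, and
  later to constant coefficient 1.\<close>

lemma Lp_norm_char_comb_scale:
  assumes "0 < p"
  shows "Lp_norm p (char_comb (s * a) (s * b) (s * c)) = norm s * Lp_norm p (char_comb a b c)"
proof -
  have "char_comb (s * a) (s * b) (s * c) k = s * char_comb a b c k" for k
    by (simp add: char_comb_def algebra_simps)
  then have "Lp_norm p (char_comb (s * a) (s * b) (s * c)) =
      (norm s powr p * (1 / 3 * (\<Sum>k\<in>UNIV. norm (char_comb a b c k) powr p))) powr (1 / p)"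
    by (simp add: Lp_norm_def norm_mult powr_mult sum_distrib_left)
  also have "\<dots> = norm s * Lp_norm p (char_comb a b c)"
    unfolding Lp_norm_def using assms by (subst powr_mult) (auto simp: powr_powr intro: sum_nonneg)
  finally show ?thesis .
qed

lemma char_comb_constant_on:
  assumes "char_comb a b c constant_on UNIV"
  shows "b = 0 \<and> c = 0"
proof -
  obtain y where "char_comb a b c = char_comb y 0 0"
    using assms by (auto simp: constant_on_def char_comb_def)
  then show ?thesis by (simp add: char_comb_inject)
qed

section \<open>The extremizer as a limit of violating functions\<close>

theorem lemma1p1:
  fixes p q :: real
  assumes "1 < p" and "p < q"
  shows "\<exists>f. nontrivial_critical_extremizer p q f"
proof -
  define \<sigma> where "\<sigma> = sqrt ((p - 1) / (q - 1))"
  define t where "t = r_crit p q"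
  have p: "1 \<le> p" "0 < p" "0 < q" using assms by auto
  note crit = r_crit_greatest[OF p(1,3), folded t_def]
  have \<sigma>: "0 < \<sigma>" "\<sigma> < 1"
    using assms by (simp_all add: \<sigma>_def)
  have "t < \<sigma>"
    using Lp_norm_less_T_sqrt[OF assms] crit(3)[of \<sigma>] \<sigma> unfolding \<sigma>_def[symmetric]
    by (meson not_less less_imp_le)
  \<comment> \<open>Violations occur only at radii above \<open>t\<close>, so the local inequality
    is needed on an interval reaching strictly beyond \<open>t\<close>, yet below \<sigma>.\<close>
  define \<rho> where "\<rho> = (t + \<sigma>) / 2"
  have \<rho>: "t < \<rho>" "\<rho> < \<sigma>" "0 \<le> \<rho>" "\<rho> < 1"
    using \<open>t < \<sigma>\<close> \<sigma> crit(1) by (auto simp: \<rho>_def)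
  obtain \<delta> where "0 < \<delta>" and \<delta>: "\<And>r b c. 0 \<le> r \<Longrightarrow> r \<le> \<rho> \<Longrightarrow> norm b \<le> \<delta> \<Longrightarrow> norm c \<le> \<delta> \<Longrightarrow>
      Lp_norm q (T r (char_comb 1 b c)) \<le> Lp_norm p (char_comb 1 b c)"
    using Lp_norm_T_le_near_const[OF assms \<rho>(3)] \<rho>(2) unfolding \<sigma>_def by metis
  define s where "s n = t + (\<rho> - t) / real (Suc n)" for n
  have s: "t < s n" "s n \<le> \<rho>" for n
  proof -
    have "(\<rho> - t) / real (Suc n) \<le> (\<rho> - t) / 1"
      using \<rho> by (intro divide_left_mono) auto
    then show "s n \<le> \<rho>" by (simp add: s_def)
  qed (use \<rho> in \<open>simp add: s_def\<close>)
  have "s \<longlonglongrightarrow> t + 0"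
    unfolding s_def using LIMSEQ_Suc[OF lim_const_over_n[of "\<rho> - t"]] by (intro tendsto_add) auto
  then have s_lim: "s \<longlonglongrightarrow> t" by simp
  \<comment> \<open>Violation is expressed through coefficient triples, so that the compactness of
    the unit sphere and joint continuity in radius and coefficients can be used.\<close>
  define bad where "bad r x = (case x of (a, b, c) \<Rightarrow>
      Lp_norm p (char_comb a b c) < Lp_norm q (char_comb a (of_real r * b) (of_real r * c)))" for r and x :: "complex \<times> complex \<times> complex"
  \<comment> \<open>By maximality of \<open>t\<close> the inequality fails at some radius up to
    \<open>s n\<close>, and such a radius exceeds \<open>t\<close>.\<close>
  have "\<exists>r x. t < r \<and> r \<le> s n \<and> x \<in> sphere 0 1 \<and> bad r x" for n
  proof -
    have "\<not> s n \<le> t" "0 \<le> s n" "s n \<le> 1"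
      using s[of n] crit(1) \<rho> by auto
    then obtain r f where rf: "0 \<le> r" "r \<le> s n" "Lp_norm p f < Lp_norm q (T r f)"
      using crit(4)[of "s n"] by (meson not_less)
    then have "t < r"
      using crit(3) by (meson not_less)
    obtain a b c where f: "f = char_comb a b c"
      using char_comb_exists by blast
    define m where "m = norm (a, b, c)"
    \<comment> \<open>Zero coefficients would make both norms 0, contradicting the strict violation;
      hence normalisation is possible.\<close>
    have "m \<noteq> 0"
    proof
      assume "m = 0"
      then have "a = 0" "b = 0" "c = 0" by (auto simp: m_def zero_prod_def)
      then show False
        using rf(3) by (simp add: f T_char_comb) (simp add: Lp_norm_def char_comb_def)
    qed
    then have "m > 0" by (simp add: m_def)
    define i :: complex where "i = of_real (inverse m)"
    have "bad r (i * a, i * b, i * c)"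
      using rf(3) \<open>m > 0\<close> Lp_norm_char_comb_scale[OF p(2), of i a b c]
        Lp_norm_char_comb_scale[OF p(3), of i a "of_real r * b" "of_real r * c"]
      by (simp add: bad_def f T_char_comb i_def mult.left_commute)
    moreover have scaled: "(i * a, i * b, i * c) = inverse m *\<^sub>R (a, b, c)"
      by (simp add: i_def scaleR_conv_of_real)
    then have "(i * a, i * b, i * c) \<in> sphere 0 1"
      unfolding scaled using \<open>m > 0\<close> by (simp add: m_def del: scaleR_Pair)
    ultimately show ?thesis
      using rf(2) \<open>t < r\<close> by blast
  qed
  then obtain R X where R: "\<And>n. t < R n" "\<And>n. R n \<le> s n" and X: "\<And>n. X n \<in> sphere 0 1"
    and bad: "\<And>n. bad (R n) (X n)"
    by metis
  have "compact (sphere 0 1 :: (complex \<times> complex \<times> complex) set)"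
    by simp
  then obtain x h where x: "x \<in> sphere 0 1" and h: "strict_mono h" and lim: "(X \<circ> h) \<longlonglongrightarrow> x"
    using X unfolding compact_def by metis
  define a b c where "a n = fst (X (h n))" and "b n = fst (snd (X (h n)))" and "c n = snd (snd (X (h n)))" for n
  obtain a' b' c' where x_eq: "x = (a', b', c')" by (cases x) auto
  have lims: "a \<longlonglongrightarrow> a'" "b \<longlonglongrightarrow> b'" "c \<longlonglongrightarrow> c'"
    using tendsto_fst[OF lim] tendsto_fst[OF tendsto_snd[OF lim]] tendsto_snd[OF tendsto_snd[OF lim]]
    by (simp_all add: x_eq a_def[abs_def] b_def[abs_def] c_def[abs_def] o_def)
  have "R \<longlonglongrightarrow> t"
    using R by (intro tendsto_sandwich[OF _ _ tendsto_const s_lim] always_eventually) (auto intro: less_imp_le)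
  then have R_lim: "(\<lambda>n. R (h n)) \<longlonglongrightarrow> t"
    using LIMSEQ_subseq_LIMSEQ[OF _ h, of R t] by (simp add: o_def)
  have lt: "Lp_norm p (char_comb (a n) (b n) (c n)) < Lp_norm q (char_comb (a n) (of_real (R (h n)) * b n) (of_real (R (h n)) * c n))" for n
    using bad[of "h n"] by (simp add: bad_def a_def b_def c_def split_beta)
  \<comment> \<open>The strict violations become a weak inequality in the limit; the opposite
    inequality is the critical bound at \<open>t\<close> itself.\<close>
  have "Lp_norm p (char_comb a' b' c') \<le> Lp_norm q (char_comb a' (of_real t * b') (of_real t * c'))"
  proof (rule tendsto_le[OF sequentially_bot])
    show "(\<lambda>n. Lp_norm p (char_comb (a n) (b n) (c n))) \<longlonglongrightarrow> Lp_norm p (char_comb a' b' c')"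
      by (intro tendsto_Lp_norm_char_comb p lims)
    show "(\<lambda>n. Lp_norm q (char_comb (a n) (of_real (R (h n)) * b n) (of_real (R (h n)) * c n)))
        \<longlonglongrightarrow> Lp_norm q (char_comb a' (of_real t * b') (of_real t * c'))"
      by (intro tendsto_Lp_norm_char_comb p lims tendsto_mult tendsto_of_real R_lim)
  qed (simp_all add: lt less_imp_le)
  moreover have "Lp_norm q (T t (char_comb a' b' c')) \<le> Lp_norm p (char_comb a' b' c')"
    using crit(1) by (intro crit(3)) auto
  ultimately have eq: "Lp_norm q (T t (char_comb a' b' c')) = Lp_norm p (char_comb a' b' c')"
    by (simp add: T_char_comb)
  have "\<not> (b' = 0 \<and> c' = 0)"
  proof
    assume 0: "b' = 0 \<and> c' = 0"
    then have "a' \<noteq> 0"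
      using x by (auto simp: x_eq)
    \<comment> \<open>If the limit were constant, dividing by \<open>a n\<close> would eventually
      put the violating functions in the \<delta>-neighbourhood of 1, at radii at most \<rho>, where
      no violation is possible.\<close>
    have "(\<lambda>n. b n / a n) \<longlonglongrightarrow> 0" "(\<lambda>n. c n / a n) \<longlonglongrightarrow> 0"
      using tendsto_divide[OF lims(2,1) \<open>a' \<noteq> 0\<close>] tendsto_divide[OF lims(3,1) \<open>a' \<noteq> 0\<close>] 0 by auto
    then have "\<forall>\<^sub>F n in sequentially. dist (b n / a n) 0 < \<delta>" "\<forall>\<^sub>F n in sequentially. dist (c n / a n) 0 < \<delta>"
      using \<open>0 < \<delta>\<close> by (auto dest: tendstoD)
    moreover have "\<forall>\<^sub>F n in sequentially. a n \<noteq> 0"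
      using lims(1) \<open>a' \<noteq> 0\<close> by (rule tendsto_imp_eventually_ne)
    ultimately have "\<forall>\<^sub>F n in sequentially. dist (b n / a n) 0 < \<delta> \<and> dist (c n / a n) 0 < \<delta> \<and> a n \<noteq> 0"
      by (intro eventually_conj)
    then obtain n where n: "dist (b n / a n) 0 < \<delta>" "dist (c n / a n) 0 < \<delta>" "a n \<noteq> 0"
      using eventually_happens'[OF sequentially_bot] by blast
    define \<beta> \<gamma> where "\<beta> = b n / a n" and "\<gamma> = c n / a n"
    have "b n = a n * \<beta>" "c n = a n * \<gamma>"
      using n by (simp_all add: \<beta>_def \<gamma>_def)
    then have "norm (a n) * Lp_norm p (char_comb 1 \<beta> \<gamma>) < norm (a n) * Lp_norm q (T (R (h n)) (char_comb 1 \<beta> \<gamma>))"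
      using lt[of n] Lp_norm_char_comb_scale[OF p(2), of "a n" 1 \<beta> \<gamma>]
        Lp_norm_char_comb_scale[OF p(3), of "a n" 1 "of_real (R (h n)) * \<beta>" "of_real (R (h n)) * \<gamma>"]
      by (simp add: T_char_comb mult.left_commute)
    moreover have "0 \<le> R (h n)" "R (h n) \<le> \<rho>"
      using R[of "h n"] s(2)[of "h n"] crit(1) by linarith+
    then have "Lp_norm q (T (R (h n)) (char_comb 1 \<beta> \<gamma>)) \<le> Lp_norm p (char_comb 1 \<beta> \<gamma>)"
      using n by (intro \<delta>) (auto simp: \<beta>_def \<gamma>_def dist_norm)
    ultimately show False
      using n by (simp add: mult_less_cancel_left)
  qed
  then have "\<not> char_comb a' b' c' constant_on UNIV"
    using char_comb_constant_on by blast
  with eq show ?thesis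
    unfolding nontrivial_critical_extremizer_def t_def by blast
qed

end
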